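(* Let $A=[a_{i,j}]\in\mathbb{R}^{N\times N}$ be row stochastic with $\underline{a}:=\min_{i} a_{i,i}>0$ and with strongly connected associated digraph, and let $q=\mathrm{col}(q_1,\dots,q_N)$ be its (normalized, entrywise positive) left Perron--Frobenius eigenvector. Set $Q:=\mathrm{diag}(q_1,\dots,q_N)$, $\boldsymbol A:=A\otimes I_n$ and $\boldsymbol Q:=Q\otimes I_n$. Then, for $\eta\in(1-\underline{a},1)$: (i) $A$ is $\eta$-averaged in $\mathcal H_Q$; (ii) the operator $\boldsymbol{\mathrm{prox}}_{\boldsymbol f}\circ\boldsymbol A:\mathbb{R}^{nN}\to\mathbb{R}^{nN}$ is $\frac{1}{2-\eta}$-averaged in $\mathcal H_{\boldsymbol Q}$. If $A$ is doubly stochastic, the statements hold with $Q=I$.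
   Context: Let $\mathcal N=\{1,\dots,N\}$ and let $n\ge 1$. For each $i\in\mathcal N$, $\Omega_i\subset\mathbb{R}^n$ is nonempty, compact and convex, $\iota_{\Omega_i}$ is its indicator function ($0$ on $\Omega_i$, $+\infty$ elsewhere), and $\bar f_i:=f_i+\iota_{\Omega_i}:\mathbb{R}^n\to\mathbb{R}\cup\{\infty\}$ is proper, lower semicontinuous and convex. The proximal operator is $\mathrm{prox}_{\bar f_i}(x):=\mathrm{argmin}_{y\in\mathbb{R}^n}\,\bar f_i(y)+\frac12\|x-y\|^2$, and $\boldsymbol{\mathrm{prox}}_{\boldsymbol f}(\mathrm{col}(z_1,\dots,z_N)):=\mathrm{col}(\mathrm{prox}_{\bar f_1}(z_1),\dots,\mathrm{prox}_{\bar f_N}(z_N))$ for $z_i\in\mathbb{R}^n$, where $\mathrm{col}$ stacks vectors. Row stochastic means $a_{i,j}\ge 0$ and $\sum_{j} a_{i,j}=1$ for all $i$. The digraph associated with $A$ has an edge between $i$ and $j$ according to whether $a_{i,j}>0$. The left Perron--Frobenius eigenvector is $q=\bar q/\|\bar q\|$ where $\bar q\in\mathbb{R}^N_{>0}$ satisfies $\bar q^\top A=\bar q^\top$. For a symmetric positive definite matrix $W$, $\mathcal H_W$ is the Euclidean space with inner product $\langle x\,|\,y\rangle_W=x^\top W y$ and norm $\|\cdot\|_W$. An operator $T$ is $\eta$-averaged in $\mathcal H_W$, $\eta\in(0,1)$, if $\|T(x)-T(y)\|_W^2\le\|x-y\|_W^2-\frac{1-\eta}{\eta}\|(\mathrm{Id}-T)(x)-(\mathrm{Id}-T)(y)\|_W^2$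 for all $x,y$. *)

theory Defs
  imports "Graph_Theory.Digraph_Component" "HOL-Analysis.Analysis"
begin

text \<open>
  The agents are indexed by a finite type \<open>'N\<close>, the coordinates of a local vector by a finite
  type \<open>'n\<close>. A stacked vector is a \<open>real ^ ('N \<times> 'n)\<close>; its entry at \<open>(i, k)\<close> is
  coordinate \<open>k\<close> of block \<open>i\<close>.
\<close>

definition col :: "('N::finite \<Rightarrow> real ^ 'n::finite) \<Rightarrow> real ^ ('N \<times> 'n)" where
  "col z = (\<chi> p. z (fst p) $ snd p)"

definition block :: "real ^ ('N::finite \<times> 'n::finite) \<Rightarrow> 'N \<Rightarrow> real ^ 'n" where
  "block x i = (\<chi> k. x $ (i, k))"

definition kronecker ::
    "real ^ 'c::finite ^ 'a::finite \<Rightarrow> real ^ 'd::finite ^ 'b::finite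
      \<Rightarrow> real ^ ('c \<times> 'd) ^ ('a \<times> 'b)"  (infixl \<open>\<otimes>\<^sub>K\<close> 70) where
  "A \<otimes>\<^sub>K B = (\<chi> p q. A $ fst p $ fst q * B $ snd p $ snd q)"

definition diag_matrix :: "real ^ 'N::finite \<Rightarrow> real ^ 'N ^ 'N" where
  "diag_matrix q = (\<chi> i j. if i = j then q $ i else 0)"

definition row_stochastic :: "real ^ 'N::finite ^ 'N \<Rightarrow> bool" where
  "row_stochastic A \<longleftrightarrow> (\<forall>i j. 0 \<le> A $ i $ j) \<and> (\<forall>i. (\<Sum>j\<in>UNIV. A $ i $ j) = 1)"

definition doubly_stochastic :: "real ^ 'N::finite ^ 'N \<Rightarrow> bool" where
  "doubly_stochastic A \<longleftrightarrow> row_stochastic A \<and> row_stochastic (transpose A)"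

definition min_diag :: "real ^ 'N::finite ^ 'N \<Rightarrow> real" where
  "min_diag A = Min (range (\<lambda>i. A $ i $ i))"

text \<open>
  The orientation of the arcs is a matter of convention: a digraph is strongly connected iff its
  reverse is.
\<close>

definition assoc_digraph :: "real ^ 'N::finite ^ 'N \<Rightarrow> ('N, 'N \<times> 'N) pre_digraph" where
  "assoc_digraph A = \<lparr>verts = UNIV, arcs = {(i, j). A $ i $ j > 0}, tail = fst, head = snd\<rparr>"

definition left_PF_eigenvector :: "real ^ 'N::finite ^ 'N \<Rightarrow> real ^ 'N \<Rightarrow> bool" where
  "left_PF_eigenvector A q \<longleftrightarrow>
     (\<exists>p. (\<forall>i. p $ i > 0) \<and> p v* A = p \<and> q = p /\<^sub>R norm p)"

definition sym_pos_def :: "real ^ 'm::finite ^ 'm \<Rightarrow> bool" where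
  "sym_pos_def W \<longleftrightarrow> transpose W = W \<and> (\<forall>x. x \<noteq> 0 \<longrightarrow> x \<bullet> (W *v x) > 0)"

definition inner_W :: "real ^ 'm::finite ^ 'm \<Rightarrow> real ^ 'm \<Rightarrow> real ^ 'm \<Rightarrow> real" where
  "inner_W W x y = x \<bullet> (W *v y)"

definition norm_W :: "real ^ 'm::finite ^ 'm \<Rightarrow> real ^ 'm \<Rightarrow> real" where
  "norm_W W x = sqrt (inner_W W x x)"

text \<open>
  Being averaged presupposes that \<open>W\<close> induces an inner product and that \<open>\<eta>\<close> lies strictly
  between 0 and 1; both requirements are part of the predicate.
\<close>

definition averaged ::
    "real ^ 'm::finite ^ 'm \<Rightarrow> real \<Rightarrow> (real ^ 'm \<Rightarrow> real ^ 'm) \<Rightarrow> bool" where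
  "averaged W \<eta> T \<longleftrightarrow> sym_pos_def W \<and> 0 < \<eta> \<and> \<eta> < 1 \<and>
     (\<forall>x y. (norm_W W (T x - T y))\<^sup>2
        \<le> (norm_W W (x - y))\<^sup>2 - (1 - \<eta>) / \<eta> * (norm_W W ((x - T x) - (y - T y)))\<^sup>2)"

definition convex_indicator :: "'a set \<Rightarrow> 'a \<Rightarrow> ereal" where
  "convex_indicator S x = (if x \<in> S then 0 else \<infinity>)"

text \<open>
  On \<open>ereal\<close> we have \<open>-\<infinity> + \<infinity> = \<infinity>\<close> and \<open>0 * \<infinity> = 0\<close>. Since a proper function never takes the
  value \<open>-\<infinity>\<close>, the convexity inequality is only used where the right-hand side is unambiguous.
\<close>

definition proper_fun :: "('a \<Rightarrow> ereal) \<Rightarrow> bool" where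
  "proper_fun g \<longleftrightarrow> (\<forall>x. g x \<noteq> -\<infinity>) \<and> (\<exists>x. g x \<noteq> \<infinity>)"

definition lower_semicontinuous :: "('a::topological_space \<Rightarrow> ereal) \<Rightarrow> bool" where
  "lower_semicontinuous g \<longleftrightarrow> (\<forall>x. g x \<le> Liminf (at x) g)"

definition convex_fun :: "('a::real_vector \<Rightarrow> ereal) \<Rightarrow> bool" where
  "convex_fun g \<longleftrightarrow> (\<forall>x y. \<forall>t\<in>{0..1}.
     g ((1 - t) *\<^sub>R x + t *\<^sub>R y) \<le> ereal (1 - t) * g x + ereal t * g y)"

text \<open>
  For proper, lower semicontinuous and convex \<open>g\<close> the minimiser is unique, so the choice
  made by \<open>arg_min\<close> plays no role.
\<close>

definition prox :: "(real ^ 'n::finite \<Rightarrow> ereal) \<Rightarrow> real ^ 'n \<Rightarrow> real ^ 'n" where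
  "prox g x = arg_min (\<lambda>y. g y + ereal (1 / 2 * (norm (x - y))\<^sup>2)) (\<lambda>_. True)"

definition block_prox ::
    "('N::finite \<Rightarrow> real ^ 'n::finite \<Rightarrow> ereal) \<Rightarrow> real ^ ('N \<times> 'n) \<Rightarrow> real ^ ('N \<times> 'n)" where
  "block_prox g x = col (\<lambda>i. prox (g i) (block x i))"

end

theory Submission
  imports Defs
begin

text \<open>
  Averagedness of \<open>A\<close> comes from Jensen's inequality in each row. The matrix
  \<open>(A - (1 - \<eta>) I) / \<eta>\<close> is still row stochastic, because its diagonal stays nonnegative as long as
  \<open>1 - \<eta>\<close> is at most the smallest diagonal entry of \<open>A\<close>. Jensen's inequality for its rows
  bounds the \<open>i\<close>-th averagedness defect by \<open>\<Sum>j. a\<^sub>i\<^sub>j x\<^sub>j\<^sup>2\<close>, and summing with the weights \<open>q\<^sub>i\<close> collapses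
  this to \<open>\<Sum>j. q\<^sub>j x\<^sub>j\<^sup>2\<close>, since \<open>q\<close> is a left fixed vector of \<open>A\<close>. This is
  \<open>averaged_stochastic_matrix\<close>.

  The hypotheses of that argument pass from \<open>A\<close> to \<open>A \<otimes> I\<close>, which is row stochastic, has the same
  diagonal entries, and fixes the repeated weights \<open>q \<otimes> 1\<close> from the left; so no separate
  argument is needed for stacked vectors. They also hold with \<open>q = 1\<close> when \<open>A\<close> is doubly stochastic.

  Each proximal operator is firmly nonexpansive, that is, \<open>1/2\<close>-averaged
  (\<open>prox_firmly_nonexpansive\<close>); a sum of the blockwise inequalities with the weights \<open>q\<^sub>i\<close>
  gives the same for the stacked operator. Composing a \<open>1/2\<close>-averaged with an \<open>\<eta>\<close>-averaged
  operator yields the constant \<open>1 / (2 - \<eta>)\<close> (\<open>averaged_comp_half\<close>).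
\<close>

section \<open>Weighted inner products\<close>

lemma inner_W_simps:
  "inner_W W (x + y) z = inner_W W x z + inner_W W y z"
  "inner_W W x (y + z) = inner_W W x y + inner_W W x z"
  "inner_W W (x - y) z = inner_W W x z - inner_W W y z"
  "inner_W W x (y - z) = inner_W W x y - inner_W W x z"
  "inner_W W (c *\<^sub>R x) y = c * inner_W W x y"
  "inner_W W x (c *\<^sub>R y) = c * inner_W W x y"
  by (simp_all add: inner_W_def inner_add_left inner_add_right inner_diff_left inner_diff_right
      matrix_vector_right_distrib matrix_vector_mult_diff_distrib matrix_vector_mult_scaleR)

lemma inner_W_nonneg:
  assumes "sym_pos_def W"
  shows "0 \<le> inner_W W x x"
  using assms unfolding sym_pos_def_def inner_W_def by (cases "x = 0") (auto intro: less_imp_le)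

lemma norm_W_power2:
  assumes "sym_pos_def W"
  shows "(norm_W W x)\<^sup>2 = inner_W W x x"
  by (simp add: norm_W_def inner_W_nonneg[OF assms])

lemma inner_W_diag_matrix: "inner_W (diag_matrix q) x x = (\<Sum>i\<in>UNIV. q $ i * (x $ i)\<^sup>2)"
  unfolding inner_W_def inner_vec_def diag_matrix_def matrix_vector_mult_def
  by (intro sum.cong)
    (simp_all add: if_distrib[where f = "\<lambda>c. c * _"] power2_eq_square cong: if_cong)

lemma sym_pos_def_diag_matrix:
  assumes "\<And>i. 0 < q $ i"
  shows "sym_pos_def (diag_matrix q)"
  unfolding sym_pos_def_def
proof (intro conjI allI impI)
  show "transpose (diag_matrix q) = diag_matrix q"
    by (simp add: transpose_def diag_matrix_def vec_eq_iff)
  fix x :: "real ^ 'a"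
  assume "x \<noteq> 0"
  then obtain i where "x $ i \<noteq> 0"
    by (auto simp: vec_eq_iff)
  then have "0 < (\<Sum>i\<in>UNIV. q $ i * (x $ i)\<^sup>2)"
    using assms by (intro sum_pos2[where i = i]) (auto simp: less_imp_le)
  then show "0 < x \<bullet> (diag_matrix q *v x)"
    by (simp flip: inner_W_diag_matrix add: inner_W_def)
qed

section \<open>Composition of averaged operators\<close>

text \<open>
  With \<open>a\<close> and \<open>b\<close> the displacements of the two factors, the composition satisfies the averagedness
  inequality with \<open>(1 - \<eta>) / \<eta> * \<parallel>a\<parallel>\<^sup>2 + \<parallel>b\<parallel>\<^sup>2\<close> in place of a multiple of \<open>\<parallel>a + b\<parallel>\<^sup>2\<close>. The factor
  \<open>1 - \<eta>\<close> is the largest one that can be extracted: the difference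
  \<open>(1 - \<eta>) / \<eta> * \<parallel>a\<parallel>\<^sup>2 + \<parallel>b\<parallel>\<^sup>2 - (1 - \<eta>) * \<parallel>a + b\<parallel>\<^sup>2\<close> is the perfect square
  \<open>\<eta> * \<parallel>(1 - \<eta>) / \<eta> * a - b\<parallel>\<^sup>2\<close>.
\<close>

lemma averaged_comp_half:
  assumes T: "averaged W (1 / 2) T" and S: "averaged W \<eta> S"
  shows "averaged W (1 / (2 - \<eta>)) (T \<circ> S)"
proof -
  have W: "sym_pos_def W" and \<eta>: "0 < \<eta>" "\<eta> < 1"
    using S by (auto simp: averaged_def)
  note nW = norm_W_power2[OF W]
  have coeff: "(1 - 1 / (2 - \<eta>)) / (1 / (2 - \<eta>)) = 1 - \<eta>"
    using \<eta> by (simp add: field_simps)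
  have "inner_W W (T (S x) - T (S y)) (T (S x) - T (S y)) \<le>
    inner_W W (x - y) (x - y) - (1 - \<eta>) *
      inner_W W ((x - T (S x)) - (y - T (S y))) ((x - T (S x)) - (y - T (S y)))" for x y
  proof -
    define a where "a = (x - S x) - (y - S y)"
    define b where "b = (S x - T (S x)) - (S y - T (S y))"
    define c where "c = (1 - \<eta>) / \<eta>"
    have ab: "(x - T (S x)) - (y - T (S y)) = a + b"
      by (simp add: a_def b_def)
    have 1: "inner_W W (T (S x) - T (S y)) (T (S x) - T (S y))
        \<le> inner_W W (S x - S y) (S x - S y) - inner_W W b b"
      using T by (auto simp: averaged_def nW b_def)
    have 2: "inner_W W (S x - S y) (S x - S y) \<le> inner_W W (x - y) (x - y) - c * inner_W W a a"
      using S by (auto simp: averaged_def nW a_def c_def)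
    have "0 \<le> \<eta> * inner_W W (c *\<^sub>R a - b) (c *\<^sub>R a - b)"
      using \<eta> inner_W_nonneg[OF W] by (intro mult_nonneg_nonneg) auto
    also have "\<dots> = (\<eta> * c) * c * inner_W W a a - (\<eta> * c) * inner_W W a b
        - (\<eta> * c) * inner_W W b a + \<eta> * inner_W W b b"
      by (simp add: inner_W_simps algebra_simps)
    also have "\<eta> * c = 1 - \<eta>"
      using \<eta> by (simp add: c_def)
    also have "(1 - \<eta>) * c = c - (1 - \<eta>)"
      using \<eta> by (simp add: c_def field_simps)
    finally have "(1 - \<eta>) * inner_W W (a + b) (a + b) \<le> c * inner_W W a a + inner_W W b b"
      by (simp add: inner_W_simps algebra_simps)
    with 1 2 show ?thesis
      unfolding ab by linarith
  qed
  then show ?thesis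
    unfolding averaged_def coeff using W \<eta> by (simp add: nW)
qed

section \<open>Stochastic matrices with positive diagonal\<close>

text \<open>
  Jensen's inequality for the row \<open>a\<close> after a mass \<open>1 - \<eta>\<close> has been removed from its entry
  at \<open>i\<close> and the rest has been rescaled to total mass \<open>1\<close>.
\<close>

lemma lazy_row_Jensen:
  fixes a u :: "'a::finite \<Rightarrow> real"
  assumes nonneg: "\<And>j. 0 \<le> a j" and total: "(\<Sum>j\<in>UNIV. a j) = 1"
    and lazy: "1 - \<eta> \<le> a i" and \<eta>: "0 < \<eta>"
  defines "v \<equiv> (\<Sum>j\<in>UNIV. a j * u j)"
  shows "v\<^sup>2 + (1 - \<eta>) / \<eta> * (u i - v)\<^sup>2 \<le> (\<Sum>j\<in>UNIV. a j * (u j)\<^sup>2)"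
proof -
  define b where "b j = (a j - (if j = i then 1 - \<eta> else 0)) / \<eta>" for j
  have b_sum: "(\<Sum>j\<in>UNIV. b j * h j) = ((\<Sum>j\<in>UNIV. a j * h j) - (1 - \<eta>) * h i) / \<eta>" for h
  proof -
    have "(\<Sum>j\<in>UNIV. b j * h j) = (\<Sum>j\<in>UNIV. a j * h j - (if j = i then (1 - \<eta>) * h i else 0)) / \<eta>"
      unfolding sum_divide_distrib b_def
      by (intro sum.cong) (auto simp: algebra_simps diff_divide_distrib)
    then show ?thesis
      by (simp add: sum_subtractf)
  qed
  have b_total: "(\<Sum>j\<in>UNIV. b j) = 1"
    using b_sum[of "\<lambda>_. 1"] total \<eta> by simp
  have b_nonneg: "0 \<le> b j" for j
    using nonneg lazy \<eta> by (auto simp: b_def)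
  have "(\<Sum>j\<in>UNIV. b j *\<^sub>R u j)\<^sup>2 \<le> (\<Sum>j\<in>UNIV. b j * (u j)\<^sup>2)"
    using b_total b_nonneg by (intro convex_on_sum[OF _ _ convex_power2]) auto
  then have "((v - (1 - \<eta>) * u i) / \<eta>)\<^sup>2 \<le> ((\<Sum>j\<in>UNIV. a j * (u j)\<^sup>2) - (1 - \<eta>) * (u i)\<^sup>2) / \<eta>"
    by (simp add: b_sum v_def)
  then have "\<eta> * ((v - (1 - \<eta>) * u i) / \<eta>)\<^sup>2 + (1 - \<eta>) * (u i)\<^sup>2 \<le> (\<Sum>j\<in>UNIV. a j * (u j)\<^sup>2)"
    using \<eta> by (simp add: field_simps)
  moreover have "\<eta> * ((v - (1 - \<eta>) * u i) / \<eta>)\<^sup>2 + (1 - \<eta>) * (u i)\<^sup>2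
      = v\<^sup>2 + (1 - \<eta>) / \<eta> * (u i - v)\<^sup>2"
    using \<eta> by (simp add: field_simps power2_eq_square)
  ultimately show ?thesis
    by simp
qed

lemma averaged_stochastic_matrix:
  fixes A :: "real ^ 'm::finite ^ 'm"
  assumes stoch: "row_stochastic A" and q_pos: "\<And>i. 0 < q $ i" and q_fixed: "q v* A = q"
    and lazy: "\<And>i. 1 - \<eta> \<le> A $ i $ i" and \<eta>: "0 < \<eta>" "\<eta> < 1"
  shows "averaged (diag_matrix q) \<eta> ((*v) A)"
proof -
  note W = sym_pos_def_diag_matrix[OF q_pos]
  have "inner_W (diag_matrix q) (A *v x - A *v y) (A *v x - A *v y)
      \<le> inner_W (diag_matrix q) (x - y) (x - y)
        - (1 - \<eta>) / \<eta> * inner_W (diag_matrix q) ((x - A *v x) - (y - A *v y)) ((x - A *v x) - (y - A *v y))"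
    for x y
  proof -
    define u where "u = x - y"
    define v where "v = A *v u"
    have row: "(v $ i)\<^sup>2 + (1 - \<eta>) / \<eta> * (u $ i - v $ i)\<^sup>2 \<le> (\<Sum>j\<in>UNIV. A $ i $ j * (u $ j)\<^sup>2)" for i
      unfolding v_def matrix_vector_mult_def
      using lazy_row_Jensen[of "\<lambda>j. A $ i $ j" \<eta> i "\<lambda>j. u $ j"] stoch lazy \<eta>
      by (simp add: row_stochastic_def)
    have "(\<Sum>i\<in>UNIV. q $ i * ((v $ i)\<^sup>2 + (1 - \<eta>) / \<eta> * (u $ i - v $ i)\<^sup>2))
        \<le> (\<Sum>i\<in>UNIV. q $ i * (\<Sum>j\<in>UNIV. A $ i $ j * (u $ j)\<^sup>2))"
      using row q_pos by (intro sum_mono mult_left_mono) (auto intro: less_imp_le)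
    also have "\<dots> = (\<Sum>j\<in>UNIV. (\<Sum>i\<in>UNIV. q $ i * A $ i $ j) * (u $ j)\<^sup>2)"
      unfolding sum_distrib_left sum_distrib_right by (subst sum.swap) (simp add: mult_ac)
    also have "\<dots> = (\<Sum>j\<in>UNIV. (q v* A) $ j * (u $ j)\<^sup>2)"
      by (simp add: vector_matrix_mult_def mult.commute)
    finally have "(\<Sum>i\<in>UNIV. q $ i * (v $ i)\<^sup>2)
        + (1 - \<eta>) / \<eta> * (\<Sum>i\<in>UNIV. q $ i * (u $ i - v $ i)\<^sup>2) \<le> (\<Sum>i\<in>UNIV. q $ i * (u $ i)\<^sup>2)"
      unfolding q_fixed by (simp add: sum.distrib sum_distrib_left algebra_simps)
    moreover have "A *v x - A *v y = v" "(x - A *v x) - (y - A *v y) = u - v"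
      by (simp_all add: v_def u_def matrix_vector_mult_diff_distrib)
    ultimately show ?thesis
      by (simp add: inner_W_diag_matrix flip: u_def)
  qed
  then show ?thesis
    unfolding averaged_def norm_W_power2[OF W] using W \<eta> by blast
qed

lemma mat_1_eq_diag_matrix: "mat 1 = diag_matrix 1"
  by (simp add: mat_def diag_matrix_def vec_eq_iff)

lemma diag_matrix_kronecker_mat_1:
  "diag_matrix q \<otimes>\<^sub>K mat 1 = diag_matrix (\<chi> p. q $ fst p)"
  by (auto simp: kronecker_def diag_matrix_def mat_def vec_eq_iff prod_eq_iff)

lemma sum_kronecker_mat_1:
  fixes h :: "'a::finite \<Rightarrow> real" and k :: "'b::finite"
  shows "(\<Sum>p\<in>UNIV. h (fst p) * (if snd p = k then 1 else 0)) = (\<Sum>i\<in>UNIV. h i)"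
proof -
  have "(\<Sum>p\<in>UNIV. h (fst p) * (if snd p = k then 1 else 0))
      = (\<Sum>(i, l)\<in>UNIV \<times> UNIV. h i * (if l = k then 1 else 0))"
    by (simp add: case_prod_beta)
  also have "\<dots> = (\<Sum>i\<in>UNIV. h i)"
    unfolding sum.cartesian_product[symmetric] by (simp flip: sum_distrib_left)
  finally show ?thesis .
qed

text \<open>
  An instance of \<open>averaged_stochastic_matrix\<close>: the product with the identity is again a stochastic
  matrix, with rows and weights indexed by pairs.
\<close>

lemma averaged_kronecker_stochastic_matrix:
  fixes A :: "real ^ 'm::finite ^ 'm"
  assumes stoch: "row_stochastic A" and q_pos: "\<And>i. 0 < q $ i" and q_fixed: "q v* A = q"
    and lazy: "\<And>i. 1 - \<eta> \<le> A $ i $ i" and \<eta>: "0 < \<eta>" "\<eta> < 1"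
  shows "averaged (diag_matrix q \<otimes>\<^sub>K (mat 1 :: real ^ 'n::finite ^ 'n)) \<eta>
      ((*v) (A \<otimes>\<^sub>K (mat 1 :: real ^ 'n ^ 'n)))"
  unfolding diag_matrix_kronecker_mat_1
proof (rule averaged_stochastic_matrix)
  have "(\<Sum>p\<in>UNIV. A $ i $ fst p * (if k = snd p then 1 else 0)) = 1" for i and k :: 'n
    using sum_kronecker_mat_1[of "\<lambda>j. A $ i $ j" k] stoch
    unfolding eq_commute[of k] by (simp add: row_stochastic_def)
  then show "row_stochastic (A \<otimes>\<^sub>K (mat 1 :: real ^ 'n ^ 'n))"
    using stoch by (simp add: row_stochastic_def kronecker_def mat_def)
  have "(\<Sum>p\<in>UNIV. q $ fst p * (A $ fst p $ i * (if snd p = k then 1 else 0))) = q $ i"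
    for i and k :: 'n
    using sum_kronecker_mat_1[of "\<lambda>j. q $ j * A $ j $ i" k] arg_cong[OF q_fixed, of "\<lambda>z. z $ i"]
    by (simp add: vector_matrix_mult_def mult_ac)
  then show "(\<chi> p. q $ fst p) v* (A \<otimes>\<^sub>K (mat 1 :: real ^ 'n ^ 'n)) = (\<chi> p. q $ fst p)"
    by (simp add: vec_eq_iff vector_matrix_mult_def kronecker_def mat_def mult_ac)
  show "1 - \<eta> \<le> (A \<otimes>\<^sub>K (mat 1 :: real ^ 'n ^ 'n)) $ p $ p" for p
    using lazy by (simp add: kronecker_def mat_def)
qed (use q_pos \<eta> in auto)

section \<open>Proximal operators\<close>

lemma open_superlevel_lsc_plus_continuous:
  fixes g :: "'a::topological_space \<Rightarrow> ereal" and \<phi> :: "'a \<Rightarrow> real"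
  assumes lsc: "lower_semicontinuous g" and cont: "continuous_on UNIV \<phi>"
  shows "open {y. c < g y + ereal (\<phi> y)}"
proof -
  have "\<forall>\<^sub>F z in nhds y. c < g z + ereal (\<phi> z)" if y: "c < g y + ereal (\<phi> y)" for y
  proof -
    \<comment> \<open>A real level \<open>d\<close> strictly between \<open>c - \<phi> y\<close> and \<open>g y\<close> splits the claim into one about \<open>g\<close> and one about \<open>\<phi>\<close>.\<close>
    from ereal_dense2[OF y] obtain r where r: "c < ereal r" "ereal r < g y + ereal (\<phi> y)"
      by blast
    define d where "d = r - \<phi> y"
    have d: "ereal d < g y"
      using r(2) by (cases "g y") (auto simp: d_def)
    have "g y \<le> Liminf (at y) g"
      using lsc by (simp add: lower_semicontinuous_def)
    then have "\<forall>\<^sub>F z in at y. ereal d < g z"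
      using d by (simp add: le_Liminf_iff)
    then have near_g: "\<forall>\<^sub>F z in nhds y. ereal d < g z"
      using d by (simp add: eventually_nhds_conv_at)
    have "((\<lambda>z. ereal (d + \<phi> z)) \<longlongrightarrow> ereal (d + \<phi> y)) (nhds y)"
      using cont
      by (intro tendsto_intros) (auto simp: continuous_on_def tendsto_at_iff_tendsto_nhds)
    then have near_phi: "\<forall>\<^sub>F z in nhds y. c < ereal (d + \<phi> z)"
      using r(1) by (intro order_tendstoD) (simp_all add: d_def)
    show ?thesis
      using near_g near_phi
    proof eventually_elim
      case (elim z)
      then show ?case
        by (cases "g z"; cases c) auto
    qed
  qed
  then show ?thesis
    by (subst open_subopen) (fastforce simp: eventually_nhds)
qed

text \<open>
  If no point were minimal, the open sets \<open>{y. h z < h y}\<close> with \<open>z\<close> in \<open>K\<close> would cover the compact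
  set \<open>K\<close>, but a lowest point among finitely many \<open>z\<close> is left uncovered by their sets.
\<close>

lemma compact_attains_inf_lsc:
  fixes h :: "'a::topological_space \<Rightarrow> 'b::linorder"
  assumes K: "compact K" "K \<noteq> {}" and op: "\<And>c. open {y. c < h y}"
  shows "\<exists>p\<in>K. \<forall>y\<in>K. h p \<le> h y"
proof (rule ccontr)
  assume "\<not> ?thesis"
  then have "K \<subseteq> (\<Union>z\<in>K. {y. h z < h y})"
    by (auto simp: not_le)
  from compactE_image[OF K(1) op this] obtain D
    where D: "D \<subseteq> K" "finite D" "K \<subseteq> (\<Union>z\<in>D. {y. h z < h y})"
    by blast
  have "D \<noteq> {}"
    using D K by auto
  then have "arg_min_on h D \<in> D" and "\<And>z. z \<in> D \<Longrightarrow> \<not> h z < h (arg_min_on h D)"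
    using arg_min_if_finite[OF D(2), of h] by auto
  then show False
    using D by blast
qed

text \<open>
  The value of \<open>arg_min\<close> is a minimiser only if one exists. Here the infimum is attained because
  the sum is infinite outside the compact set \<open>K\<close> and lower semicontinuous.
\<close>

lemma prox_minimal:
  fixes g :: "real ^ 'n::finite \<Rightarrow> ereal"
  assumes proper: "proper_fun g" and lsc: "lower_semicontinuous g"
    and K: "compact K" and dom: "\<And>y. y \<notin> K \<Longrightarrow> g y = \<infinity>"
  shows "g (prox g x) + ereal (1 / 2 * (norm (x - prox g x))\<^sup>2)
      \<le> g y + ereal (1 / 2 * (norm (x - y))\<^sup>2)"
proof -
  define h where "h y = g y + ereal (1 / 2 * (norm (x - y))\<^sup>2)" for y
  have "K \<noteq> {}"
    using proper dom by (auto simp: proper_fun_def)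
  moreover have "open {y. c < h y}" for c
    unfolding h_def by (intro open_superlevel_lsc_plus_continuous lsc continuous_intros)
  ultimately obtain p where p: "\<And>y. y \<in> K \<Longrightarrow> h p \<le> h y"
    using compact_attains_inf_lsc[OF K] by blast
  have "h p \<le> h y" for y
    using p[of y] dom[of y] by (cases "y \<in> K") (auto simp: h_def)
  then have "is_arg_min h (\<lambda>_. True) p"
    by (auto simp: is_arg_min_def not_less)
  then have "is_arg_min h (\<lambda>_. True) (arg_min h (\<lambda>_. True))"
    unfolding arg_min_def by (rule someI)
  moreover have "prox g x = arg_min h (\<lambda>_. True)"
    by (simp add: prox_def h_def[abs_def])
  ultimately have "h (prox g x) \<le> h y"
    by (auto simp: is_arg_min_def not_less)
  then show ?thesis
    by (simp add: h_def)
qed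

lemma prox_finite:
  fixes g :: "real ^ 'n::finite \<Rightarrow> ereal"
  assumes proper: "proper_fun g"
    and min: "\<And>y. g (prox g x) + ereal (1 / 2 * (norm (x - prox g x))\<^sup>2)
      \<le> g y + ereal (1 / 2 * (norm (x - y))\<^sup>2)"
  shows "\<bar>g (prox g x)\<bar> \<noteq> \<infinity>"
proof -
  obtain z where "g z \<noteq> \<infinity>" "g (prox g x) \<noteq> - \<infinity>"
    using proper by (auto simp: proper_fun_def)
  then show ?thesis
    using min[of z] by auto
qed

text \<open>
  First-order optimality: comparing the minimiser \<open>p\<close> with the nearby points \<open>(1 - t) p + t y\<close>
  and letting \<open>t\<close> tend to \<open>0\<close> shows that \<open>x - p\<close> is a subgradient of \<open>g\<close> at \<open>p\<close>.
\<close>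

lemma prox_subgradient:
  fixes g :: "real ^ 'n::finite \<Rightarrow> ereal"
  assumes conv: "convex_fun g"
    and min: "\<And>y. g (prox g x) + ereal (1 / 2 * (norm (x - prox g x))\<^sup>2)
      \<le> g y + ereal (1 / 2 * (norm (x - y))\<^sup>2)"
    and a: "g (prox g x) = ereal a" and b: "g y = ereal b"
  shows "(x - prox g x) \<bullet> (y - prox g x) \<le> b - a"
proof -
  define p where "p = prox g x"
  have step: "(x - p) \<bullet> (y - p) \<le> b - a + t / 2 * (norm (y - p))\<^sup>2" if t: "0 < t" "t < 1" for t
  proof -
    have "g ((1 - t) *\<^sub>R p + t *\<^sub>R y) \<le> ereal ((1 - t) * a + t * b)"
      using conv[unfolded convex_fun_def, rule_format, of t p y] t a b by (simp add: p_def)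
    then have "ereal a + ereal (1 / 2 * (norm (x - p))\<^sup>2)
        \<le> ereal ((1 - t) * a + t * b) + ereal (1 / 2 * (norm (x - ((1 - t) *\<^sub>R p + t *\<^sub>R y)))\<^sup>2)"
      using order_trans[OF min[of "(1 - t) *\<^sub>R p + t *\<^sub>R y"] add_right_mono] a
      by (simp only: p_def)
    then have "a + 1 / 2 * (norm (x - p))\<^sup>2
        \<le> (1 - t) * a + t * b + 1 / 2 * (norm ((x - p) - t *\<^sub>R (y - p)))\<^sup>2"
      by (simp add: algebra_simps)
    moreover have "(norm ((x - p) - t *\<^sub>R (y - p)))\<^sup>2
        = (norm (x - p))\<^sup>2 - 2 * t * ((x - p) \<bullet> (y - p)) + t * t * (norm (y - p))\<^sup>2"
      unfolding power2_norm_eq_inner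
      by (simp add: inner_diff_left inner_diff_right inner_commute algebra_simps)
    ultimately have "t * ((x - p) \<bullet> (y - p)) \<le> t * (b - a + t / 2 * (norm (y - p))\<^sup>2)"
      by (simp add: algebra_simps)
    then show ?thesis
      using t by simp
  qed
  have "((\<lambda>t. b - a + t / 2 * (norm (y - p))\<^sup>2) \<longlongrightarrow> b - a + 0 / 2 * (norm (y - p))\<^sup>2) (at_right 0)"
    by (intro tendsto_intros) simp
  moreover have "\<forall>\<^sub>F t in at_right 0. (x - p) \<bullet> (y - p) \<le> b - a + t / 2 * (norm (y - p))\<^sup>2"
    unfolding eventually_at_right_field by (intro exI[of _ 1] conjI allI impI step) auto
  ultimately have "(x - p) \<bullet> (y - p) \<le> b - a + 0 / 2 * (norm (y - p))\<^sup>2"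
    by (rule tendsto_lowerbound) simp
  then show ?thesis
    by (simp add: p_def)
qed

text \<open>
  Adding the subgradient inequalities at the two proximal points, each tested against the other,
  cancels the values of \<open>g\<close>.
\<close>

lemma prox_firmly_nonexpansive:
  fixes g :: "real ^ 'n::finite \<Rightarrow> ereal"
  assumes proper: "proper_fun g" and lsc: "lower_semicontinuous g" and conv: "convex_fun g"
    and K: "compact K" and dom: "\<And>y. y \<notin> K \<Longrightarrow> g y = \<infinity>"
  shows "(norm (prox g x - prox g y))\<^sup>2
      \<le> (norm (x - y))\<^sup>2 - (norm ((x - prox g x) - (y - prox g y)))\<^sup>2"
proof -
  note min = prox_minimal[OF proper lsc K dom]
  obtain a b where ab: "g (prox g x) = ereal a" "g (prox g y) = ereal b"
    using prox_finite[OF proper min] by (metis ereal_infinity_cases ereal_real')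
  have "(x - prox g x) \<bullet> (prox g y - prox g x) \<le> b - a"
    and "(y - prox g y) \<bullet> (prox g x - prox g y) \<le> a - b"
    using prox_subgradient[OF conv min] ab by blast+
  then show ?thesis
    unfolding power2_norm_eq_inner
    by (simp add: inner_diff_left inner_diff_right inner_commute algebra_simps)
qed

text \<open>
  All coordinates of block \<open>i\<close> carry the same weight \<open>q\<^sub>i\<close>, so the weighted norm only sees the
  Euclidean norms of the blocks, in which each proximal operator is firmly nonexpansive. With
  weights varying inside a block this can fail, as a proximal operator need not be nonexpansive
  in other norms.
\<close>

lemma averaged_block_prox:
  fixes g :: "'m::finite \<Rightarrow> real ^ 'n::finite \<Rightarrow> ereal"
  assumes q_pos: "\<And>i. 0 < q $ i"
    and firm: "\<And>i x y. (norm (prox (g i) x - prox (g i) y))\<^sup>2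
      \<le> (norm (x - y))\<^sup>2 - (norm ((x - prox (g i) x) - (y - prox (g i) y)))\<^sup>2"
  shows "averaged (diag_matrix q \<otimes>\<^sub>K (mat 1 :: real ^ 'n ^ 'n)) (1 / 2) (block_prox g)"
proof -
  let ?W = "diag_matrix q \<otimes>\<^sub>K (mat 1 :: real ^ 'n ^ 'n)"
  have W: "sym_pos_def ?W"
    unfolding diag_matrix_kronecker_mat_1 by (rule sym_pos_def_diag_matrix) (simp add: q_pos)
  have inner_block: "inner_W ?W x x = (\<Sum>i\<in>UNIV. q $ i * (norm (block x i))\<^sup>2)" for x
  proof -
    have "inner_W ?W x x = (\<Sum>(i, k)\<in>UNIV \<times> UNIV. q $ i * (x $ (i, k))\<^sup>2)"
      by (simp add: diag_matrix_kronecker_mat_1 inner_W_diag_matrix case_prod_beta)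
    also have "\<dots> = (\<Sum>i\<in>UNIV. q $ i * (norm (block x i))\<^sup>2)"
      unfolding sum.cartesian_product[symmetric] power2_norm_eq_inner inner_vec_def
      by (simp add: block_def sum_distrib_left power2_eq_square)
    finally show ?thesis .
  qed
  have block_simps: "block (x - y) i = block x i - block y i"
    "block (block_prox g x) i = prox (g i) (block x i)" for x y i
    by (simp_all add: block_def block_prox_def col_def vec_eq_iff)
  have "inner_W ?W (block_prox g x - block_prox g y) (block_prox g x - block_prox g y)
      \<le> inner_W ?W (x - y) (x - y) - inner_W ?W
        ((x - block_prox g x) - (y - block_prox g y)) ((x - block_prox g x) - (y - block_prox g y))"
    for x y
    unfolding inner_block block_simps sum_subtractf[symmetric] right_diff_distrib[symmetric]
    using q_pos firm by (intro sum_mono mult_left_mono) (auto intro: less_imp_le)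
  then show ?thesis
    unfolding averaged_def norm_W_power2[OF W] using W by simp
qed

section \<open>The averagedness constants\<close>

theorem lemma1:
  fixes A :: "real ^ 'N::finite ^ 'N"
    and q :: "real ^ 'N"
    and \<Omega> :: "'N \<Rightarrow> (real ^ 'n::finite) set"
    and f fbar :: "'N \<Rightarrow> real ^ 'n \<Rightarrow> ereal"
    and \<eta> :: real
  assumes "\<And>i. \<Omega> i \<noteq> {}" and "\<And>i. compact (\<Omega> i)" and "\<And>i. convex (\<Omega> i)"
    and "\<And>i x. fbar i x = f i x + convex_indicator (\<Omega> i) x"
    and "\<And>i. proper_fun (fbar i)"
    and "\<And>i. lower_semicontinuous (fbar i)"
    and "\<And>i. convex_fun (fbar i)"
    and "row_stochastic A"
    and "min_diag A > 0"
    and "strongly_connected (assoc_digraph A)"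
    and "left_PF_eigenvector A q"
    and "1 - min_diag A < \<eta>" and "\<eta> < 1"
  shows "averaged (diag_matrix q) \<eta> ((*v) A)
    \<and> averaged (diag_matrix q \<otimes>\<^sub>K (mat 1 :: real ^ 'n ^ 'n)) (1 / (2 - \<eta>))
        (block_prox fbar \<circ> (*v) (A \<otimes>\<^sub>K (mat 1 :: real ^ 'n ^ 'n)))
    \<and> (doubly_stochastic A \<longrightarrow>
        averaged (mat 1 :: real ^ 'N ^ 'N) \<eta> ((*v) A)
        \<and> averaged ((mat 1 :: real ^ 'N ^ 'N) \<otimes>\<^sub>K (mat 1 :: real ^ 'n ^ 'n)) (1 / (2 - \<eta>))
            (block_prox fbar \<circ> (*v) (A \<otimes>\<^sub>K (mat 1 :: real ^ 'n ^ 'n))))"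
proof -
  have diag_le: "min_diag A \<le> A $ i $ i" for i
    unfolding min_diag_def by (rule Min_le) auto
  have diag_le_1: "A $ i $ i \<le> 1" for i
  proof -
    have "A $ i $ i \<le> (\<Sum>j\<in>UNIV. A $ i $ j)"
      using \<open>row_stochastic A\<close> by (intro member_le_sum) (auto simp: row_stochastic_def)
    then show ?thesis
      using \<open>row_stochastic A\<close> by (simp add: row_stochastic_def)
  qed
  have lazy: "1 - \<eta> \<le> A $ i $ i" for i
    using diag_le[of i] \<open>1 - min_diag A < \<eta>\<close> by linarith
  \<comment> \<open>Any index will do: \<open>undefined\<close> only witnesses that there is one.\<close>
  have \<eta>: "0 < \<eta>"
    using diag_le[of undefined] diag_le_1[of undefined] \<open>1 - min_diag A < \<eta>\<close>
    by linarith
  have firm: "(norm (prox (fbar i) x - prox (fbar i) y))\<^sup>2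
      \<le> (norm (x - y))\<^sup>2 - (norm ((x - prox (fbar i) x) - (y - prox (fbar i) y)))\<^sup>2" for i x y
    using assms(2,4,5,6,7)
    by (intro prox_firmly_nonexpansive[where K = "\<Omega> i"]) (simp_all add: convex_indicator_def)
  \<comment> \<open>Kept general in the weights, to cover both \<open>q\<close> and the constant weights of the doubly stochastic case.\<close>
  have main: "averaged (diag_matrix w) \<eta> ((*v) A)
      \<and> averaged (diag_matrix w \<otimes>\<^sub>K (mat 1 :: real ^ 'n ^ 'n)) (1 / (2 - \<eta>))
        (block_prox fbar \<circ> (*v) (A \<otimes>\<^sub>K (mat 1 :: real ^ 'n ^ 'n)))"
    if w: "\<And>i. 0 < w $ i" "w v* A = w" for w
    using averaged_stochastic_matrix[OF \<open>row_stochastic A\<close> w lazy \<eta> \<open>\<eta> < 1\<close>]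
      averaged_comp_half[OF averaged_block_prox[where g = fbar, OF w(1) firm]
        averaged_kronecker_stochastic_matrix[OF \<open>row_stochastic A\<close> w lazy \<eta> \<open>\<eta> < 1\<close>]]
    by blast
  obtain p where p: "\<And>i. 0 < p $ i" "p v* A = p" and q: "q = p /\<^sub>R norm p"
    using \<open>left_PF_eigenvector A q\<close> by (auto simp: left_PF_eigenvector_def)
  have "p \<noteq> 0"
    using p(1) by (metis less_irrefl zero_index)
  then have q_pos: "0 < q $ i" for i
    using p(1) by (simp add: q)
  have q_fixed: "q v* A = q"
    using p(2) by (simp add: q scaleR_vector_matrix_assoc)
  have ones_fixed: "1 v* A = 1" if "doubly_stochastic A"
    using that
    by (simp add: doubly_stochastic_def row_stochastic_def transpose_def vector_matrix_mult_def
        vec_eq_iff)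
  have ones_pos: "0 < (1 :: real ^ 'N) $ i" for i
    by simp
  show ?thesis
    unfolding mat_1_eq_diag_matrix[where 'a = 'N]
    using main[OF q_pos q_fixed] main[OF ones_pos ones_fixed] by blast
qed

end
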